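(* Let $\mathscr{C}$ be an $n$-spherical $\{-\frac15,\frac15\}$-code with $n\ge 276$. Assume that $\lambda_1(M_{\mathscr{C}})>12$ and that there exists an eigenvector of $M_{\mathscr{C}}$ corresponding to $\lambda_1(M_{\mathscr{C}})$ without negative coordinates. Then the graph $G$ associated with $\mathscr{C}$ satisfies $\Delta_G\le 14$.
   Context: For $\alpha\in(0,1)$, a spherical $\{-\alpha,\alpha\}$-code in $\mathbb{R}^d$ is a set of unit vectors in $\mathbb{R}^d$ such that the inner product of any two distinct vectors is either $\alpha$ or $-\alpha$; it is an $n$-spherical $\{-\alpha,\alpha\}$-code if it consists of $n$ vectors (here the ambient dimension $d$ is arbitrary). For $\mathscr{C}=\{v_1,\dots,v_n\}$, the Gram matrix is $M_{\mathscr{C}}=(\langle v_i,v_j\rangle)_{1\le i,j\le n}$, and $\lambda_1(M_{\mathscr{C}})$ denotes its largest eigenvalue. The graph associated with $\mathscr{C}$ has vertex set $\{v_1,\dots,v_n\}$, with $v_i$ and $v_j$ adjacent if and only if $\langle v_i,v_j\rangle=-\alpha$. $\Delta_G$ is the maximum degree of $G$. *)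

theory Defs
  imports
    "HOL-Analysis.Finite_Cartesian_Product"
    "HOL-Analysis.Euclidean_Space"
    "Jordan_Normal_Form.Spectral_Radius"
begin

text \<open>
  Jordan_Normal_Form and HOL-Analysis both use the infix symbols for the inner product and for
  vector components. Code vectors live in \<open>real ^ 'd\<close> and use \<^const>\<open>inner\<close>; the Gram matrix
  and its eigenvectors have type \<open>real mat\<close> and \<open>real Matrix.vec\<close>.
\<close>

definition spherical_code :: "real \<Rightarrow> (real ^ 'd) set \<Rightarrow> bool" where
  "spherical_code \<alpha> C \<longleftrightarrow>
     (\<forall>u\<in>C. norm u = 1) \<and>
     (\<forall>u\<in>C. \<forall>w\<in>C. u \<noteq> w \<longrightarrow> inner u w = \<alpha> \<or> inner u w = - \<alpha>)"

definition n_spherical_code :: "nat \<Rightarrow> real \<Rightarrow> (real ^ 'd) set \<Rightarrow> bool" where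
  "n_spherical_code n \<alpha> C \<longleftrightarrow> spherical_code \<alpha> C \<and> finite C \<and> card C = n"

definition gram_matrix :: "nat \<Rightarrow> (nat \<Rightarrow> real ^ 'd) \<Rightarrow> real mat" where
  "gram_matrix n v = mat n n (\<lambda>(i, j). inner (v i) (v j))"

text \<open>
  The maximum is over the real eigenvalues. It is meaningful for a symmetric matrix of positive
  size, whose spectrum is finite, nonempty and real.
\<close>

definition largest_eigenvalue :: "real mat \<Rightarrow> real" where
  "largest_eigenvalue A = Max (spectrum A)"

text \<open>A graph is a pair of a vertex set and a set of two-element subsets of it.\<close>

type_synonym 'v ugraph = "'v set \<times> 'v set set"

definition neighbours :: "'v ugraph \<Rightarrow> 'v \<Rightarrow> 'v set" where
  "neighbours G u = {w \<in> fst G. {u, w} \<in> snd G}"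

definition max_degree :: "'v ugraph \<Rightarrow> nat" where
  "max_degree G = Max ((\<lambda>u. card (neighbours G u)) ` fst G)"

definition code_graph :: "real \<Rightarrow> (real ^ 'd) set \<Rightarrow> (real ^ 'd) ugraph" where
  "code_graph \<alpha> C = (C, {{u, w} | u w. u \<in> C \<and> w \<in> C \<and> u \<noteq> w \<and> inner u w = - \<alpha>})"

end

theory Submission
  imports Defs "HOL-Analysis.Convex"
begin

text \<open>
  Let \<open>y\<close> be the unit vector in the direction of \<open>\<Sum>i<n. x i *\<^sub>R v i\<close>, where \<open>x\<close> is the nonnegative
  eigenvector of the Gram matrix for its largest eigenvalue \<open>l\<close>. Then \<open>y\<close> is an eigenvector of the
  frame operator, \<open>(\<Sum>w\<in>C. (y \<bullet> w) *\<^sub>R w) = l *\<^sub>R y\<close>, and \<open>y \<bullet> w \<ge> 0\<close> for every code vector \<open>w\<close>.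

  The first idea is to pass from vectors to matrices. Distinct matrices \<open>w w\<^sup>T\<close> of an equiangular code
  have the same Frobenius inner product \<open>\<alpha>\<^sup>2\<close>, so their Gram matrix can be inverted explicitly, and Bessel's
  inequality for the projection of the symmetrised matrix \<open>y u\<^sup>T\<close> onto their span becomes an
  inequality between \<open>l\<close>, \<open>n\<close> and \<open>y \<bullet> u\<close>
  (\<open>frame_eigenvector_projection_bound\<close>). For \<open>\<alpha> = 1/5\<close> the threshold
  \<open>(1 - \<alpha>\<^sup>2) / (2 \<alpha>\<^sup>2)\<close> of that inequality is 12; above it, no code vector can be nearly
  orthogonal to \<open>y\<close>, and quantitatively \<open>(y \<bullet> u)\<^sup>2 \<ge> 1/6\<close> (\<open>one_fifth_code_uniform_projection\<close>).

  The second idea is that a cluster of \<open>k\<close> neighbours of \<open>u\<close> makes the vector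
  \<open>k u + 2 \<Sum>N(u)\<close> short, because all inner products with \<open>u\<close> are negative, while its projection onto
  \<open>y\<close> is long, because all code vectors point substantially towards \<open>y\<close>. The Cauchy--Schwarz
  inequality then bounds \<open>k\<close> (\<open>one_fifth_code_degree_bound\<close>).
\<close>

section \<open>Bessel's inequality for equiangular families\<close>

text \<open>
  The Gram matrix of the family is \<open>(1 - \<beta>) I + \<beta> J\<close>, whose inverse is again a combination of \<open>I\<close>
  and \<open>J\<close>; the left-hand side is \<open>1 - \<beta>\<close> times the squared norm of the projection of \<open>Z\<close> onto the
  span of the family.
\<close>

lemma equiangular_Bessel_inequality:
  fixes Z :: "'a :: real_inner" and q :: "'b \<Rightarrow> 'a"
  assumes fin: "finite C"
    and beta: "0 \<le> \<beta>" "\<beta> < 1"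
    and unit: "\<And>w. w \<in> C \<Longrightarrow> inner (q w) (q w) = 1"
    and angle: "\<And>u w. u \<in> C \<Longrightarrow> w \<in> C \<Longrightarrow> u \<noteq> w \<Longrightarrow> inner (q u) (q w) = \<beta>"
  shows "(\<Sum>w\<in>C. (inner Z (q w))\<^sup>2)
           - \<beta> / (1 - \<beta> + \<beta> * real (card C)) * (\<Sum>w\<in>C. inner Z (q w))\<^sup>2
         \<le> (1 - \<beta>) * inner Z Z"
proof -
  define b where "b w = inner Z (q w)" for w
  define B where "B = sum b C"
  define D where "D = 1 - \<beta> + \<beta> * real (card C)"
  define t where "t = \<beta> * B / D"
  define c where "c w = (b w - t) / (1 - \<beta>)" for w
  define P where "P = (\<Sum>w\<in>C. c w *\<^sub>R q w)"
  have D: "D > 0"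
    unfolding D_def using beta by (simp add: add_pos_nonneg)
  have t_eq: "(1 - \<beta>) * t = \<beta> * (B - real (card C) * t)"
  proof -
    have "D * t = \<beta> * B" using D by (simp add: t_def)
    thus ?thesis by (simp add: D_def algebra_simps)
  qed
  have sum_c: "sum c C = (B - real (card C) * t) / (1 - \<beta>)"
    by (simp add: c_def B_def sum_subtractf flip: sum_divide_distrib)
  \<comment> \<open>\<open>P\<close> is the orthogonal projection: it has the same inner products with the family as \<open>Z\<close>.\<close>
  have P_inner: "inner P (q w) = b w" if w: "w \<in> C" for w
  proof -
    have "inner P (q w) = (\<Sum>u\<in>C. c u * inner (q u) (q w))"
      by (simp add: P_def inner_sum_left)
    also have "\<dots> = (\<Sum>u\<in>C. \<beta> * c u + (if u = w then (1 - \<beta>) * c u else 0))"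
      using unit angle w by (intro sum.cong) (auto simp: algebra_simps)
    also have "\<dots> = \<beta> * sum c C + (1 - \<beta>) * c w"
      using fin w by (simp add: sum.distrib sum_distrib_left)
    also have "\<dots> = \<beta> * (B - real (card C) * t) / (1 - \<beta>) + (b w - t)"
      unfolding sum_c using beta by (simp add: c_def)
    also have "\<dots> = b w"
      using beta by (simp flip: t_eq)
    finally show ?thesis .
  qed
  have PP: "inner P P = (\<Sum>w\<in>C. c w * b w)"
  proof -
    have "inner P P = (\<Sum>w\<in>C. c w * inner P (q w))"
      by (subst (2) P_def) (simp add: inner_sum_right)
    thus ?thesis using P_inner by simp
  qed
  have ZP: "inner Z P = (\<Sum>w\<in>C. c w * b w)"
    by (simp add: P_def inner_sum_right b_def)
  have "0 \<le> inner (Z - P) (Z - P)" by simp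
  also have "\<dots> = inner Z Z - (\<Sum>w\<in>C. c w * b w)"
    using PP ZP by (simp add: inner_diff_left inner_diff_right inner_commute)
  also have "(\<Sum>w\<in>C. c w * b w) = ((\<Sum>w\<in>C. (b w)\<^sup>2) - t * B) / (1 - \<beta>)"
    by (simp add: c_def B_def power2_eq_square left_diff_distrib sum_subtractf sum_distrib_left
        flip: sum_divide_distrib)
  finally have "(\<Sum>w\<in>C. (b w)\<^sup>2) - t * B \<le> (1 - \<beta>) * inner Z Z"
    using beta by (simp add: field_simps)
  thus ?thesis
    by (simp add: t_def b_def B_def D_def power2_eq_square)
qed

section \<open>Projecting matrices onto the span of a code\<close>

text \<open>
  The inner product of \<open>real ^ 'd ^ 'd\<close> is the Frobenius inner product of matrices, so the
  rank-one matrix \<open>a b\<^sup>T\<close> can be used directly as a vector there.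
\<close>

definition outer_product :: "real ^ 'd \<Rightarrow> real ^ 'd \<Rightarrow> real ^ 'd ^ 'd" where
  "outer_product a b = (\<chi> i j. vec_nth a i * vec_nth b j)"

lemma inner_outer_product:
  "inner (outer_product a b) (outer_product c d) = inner a c * inner b d"
proof -
  have "inner (outer_product a b) (outer_product c d)
      = (\<Sum>i\<in>UNIV. \<Sum>j\<in>UNIV. (vec_nth a i * vec_nth c i) * (vec_nth b j * vec_nth d j))"
    by (simp add: outer_product_def inner_vec_def mult_ac)
  thus ?thesis
    by (simp add: inner_vec_def sum_product)
qed

lemma sum_squares_eq_frame_eigenvalue:
  fixes y :: "'a :: real_inner"
  assumes y: "norm y = 1" and frame: "(\<Sum>w\<in>C. inner y w *\<^sub>R w) = l *\<^sub>R y"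
  shows "(\<Sum>w\<in>C. (inner y w)\<^sup>2) = l"
proof -
  have "(\<Sum>w\<in>C. (inner y w)\<^sup>2) = inner y (\<Sum>w\<in>C. inner y w *\<^sub>R w)"
    by (simp add: inner_sum_right power2_eq_square)
  thus ?thesis using y by (simp add: frame norm_eq_1)
qed

text \<open>
  The right-hand side of the Bessel inequality for \<open>(y u\<^sup>T + u y\<^sup>T) / 2\<close> is bounded independently of
  \<open>n\<close>, whereas the coefficient at \<open>w\<close> is \<open>(y \<bullet> w) (u \<bullet> w)\<close>, so the sum of their squares contains
  \<open>\<alpha>\<^sup>2 \<Sum>(y \<bullet> w)\<^sup>2 = \<alpha>\<^sup>2 l\<close>. If \<open>l\<close> is large, only the square of the sum of the coefficients,
  \<open>l\<^sup>2 (y \<bullet> u)\<^sup>2\<close>, can compensate for this.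
\<close>

lemma frame_eigenvector_projection_bound:
  fixes C :: "(real ^ 'd) set" and y u :: "real ^ 'd"
  assumes code: "spherical_code \<alpha> C" and fin: "finite C"
    and alpha: "\<alpha>\<^sup>2 < 1"
    and y: "norm y = 1"
    and frame: "(\<Sum>w\<in>C. inner y w *\<^sub>R w) = l *\<^sub>R y"
    and u: "u \<in> C"
  shows "\<alpha>\<^sup>2 * l - (1 - \<alpha>\<^sup>2) / 2
         \<le> (inner y u)\<^sup>2 * (\<alpha>\<^sup>2 * l\<^sup>2 / (1 - \<alpha>\<^sup>2 + \<alpha>\<^sup>2 * real (card C)) - (1 - \<alpha>\<^sup>2) / 2)"
proof -
  define Z where "Z = (1/2) *\<^sub>R (outer_product y u + outer_product u y)"
  have yy: "inner y y = 1"
    using y by (simp add: norm_eq_1)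
  have unit: "inner w w = 1" if "w \<in> C" for w
    using code that by (simp add: spherical_code_def norm_eq_1)
  have sq: "(inner a w)\<^sup>2 = \<alpha>\<^sup>2" if "a \<in> C" "w \<in> C" "a \<noteq> w" for a w
  proof -
    have "inner a w = \<alpha> \<or> inner a w = - \<alpha>"
      using code that unfolding spherical_code_def by blast
    thus ?thesis by auto
  qed
  have coeff: "inner Z (outer_product w w) = inner y w * inner u w" for w
    by (simp add: Z_def inner_add_left inner_outer_product)
  have ZZ: "inner Z Z = (1 + (inner y u)\<^sup>2) / 2"
    using yy unit[OF u]
    by (simp add: Z_def inner_add_left inner_add_right inner_outer_product inner_commute
        power2_eq_square)
  have sum_sq: "(\<Sum>w\<in>C. (inner y w)\<^sup>2) = l"
    by (rule sum_squares_eq_frame_eigenvalue[OF y frame])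
  have sum_coeff: "(\<Sum>w\<in>C. inner y w * inner u w) = l * inner y u"
  proof -
    have "(\<Sum>w\<in>C. inner y w * inner u w) = inner u (\<Sum>w\<in>C. inner y w *\<^sub>R w)"
      by (simp add: inner_sum_right)
    thus ?thesis unfolding frame by (simp add: inner_commute)
  qed
  have sum_coeff_sq:
    "(\<Sum>w\<in>C. (inner y w * inner u w)\<^sup>2) = \<alpha>\<^sup>2 * l + (1 - \<alpha>\<^sup>2) * (inner y u)\<^sup>2"
  proof -
    have "(inner y w * inner u w)\<^sup>2
        = \<alpha>\<^sup>2 * (inner y w)\<^sup>2 + (if w = u then (1 - \<alpha>\<^sup>2) * (inner y w)\<^sup>2 else 0)"
      if "w \<in> C" for w
      using unit[OF u] sq[OF u that] by (simp add: power_mult_distrib algebra_simps)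
    hence "(\<Sum>w\<in>C. (inner y w * inner u w)\<^sup>2)
        = (\<Sum>w\<in>C. \<alpha>\<^sup>2 * (inner y w)\<^sup>2 + (if w = u then (1 - \<alpha>\<^sup>2) * (inner y w)\<^sup>2 else 0))"
      by simp
    also have "\<dots> = \<alpha>\<^sup>2 * l + (1 - \<alpha>\<^sup>2) * (inner y u)\<^sup>2"
      using fin u by (simp add: sum.distrib sum_sq flip: sum_distrib_left)
    finally show ?thesis .
  qed
  have "(\<Sum>w\<in>C. (inner Z (outer_product w w))\<^sup>2)
           - \<alpha>\<^sup>2 / (1 - \<alpha>\<^sup>2 + \<alpha>\<^sup>2 * real (card C)) * (\<Sum>w\<in>C. inner Z (outer_product w w))\<^sup>2
         \<le> (1 - \<alpha>\<^sup>2) * inner Z Z"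
    using alpha unit sq
    by (intro equiangular_Bessel_inequality fin)
       (auto simp: inner_outer_product simp flip: power2_eq_square)
  hence "\<alpha>\<^sup>2 * l + (1 - \<alpha>\<^sup>2) * (inner y u)\<^sup>2
           - \<alpha>\<^sup>2 / (1 - \<alpha>\<^sup>2 + \<alpha>\<^sup>2 * real (card C)) * (l * inner y u)\<^sup>2
         \<le> (1 - \<alpha>\<^sup>2) * ((1 + (inner y u)\<^sup>2) / 2)"
    unfolding coeff sum_coeff sum_coeff_sq ZZ .
  moreover have "\<alpha>\<^sup>2 / (1 - \<alpha>\<^sup>2 + \<alpha>\<^sup>2 * real (card C)) * (l * inner y u)\<^sup>2
      = (inner y u)\<^sup>2 * (\<alpha>\<^sup>2 * l\<^sup>2 / (1 - \<alpha>\<^sup>2 + \<alpha>\<^sup>2 * real (card C)))"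
    by (simp add: power_mult_distrib mult_ac)
  ultimately show ?thesis
    by (simp add: algebra_simps add_divide_distrib diff_divide_distrib)
qed

section \<open>Codes with inner products one fifth\<close>

text \<open>
  Writing the frame equation as a quadratic form gives \<open>l\<^sup>2 = \<Sum>(y \<bullet> a) (y \<bullet> b) (a \<bullet> b)\<close>. As the
  coefficients are nonnegative, the negative inner products \<open>a \<bullet> b\<close> may be replaced by positive
  ones, and \<open>(1 - \<alpha>) I + \<alpha> J\<close> has largest eigenvalue \<open>1 - \<alpha> + \<alpha> n\<close>.
\<close>

lemma frame_eigenvalue_upper_bound:
  fixes C :: "(real ^ 'd) set" and y :: "real ^ 'd"
  assumes code: "spherical_code \<alpha> C" and fin: "finite C"
    and alpha: "0 \<le> \<alpha>"
    and y: "norm y = 1"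
    and frame: "(\<Sum>w\<in>C. inner y w *\<^sub>R w) = l *\<^sub>R y"
    and nonneg: "\<And>w. w \<in> C \<Longrightarrow> inner y w \<ge> 0"
    and l: "l > 0"
  shows "l \<le> 1 - \<alpha> + \<alpha> * real (card C)"
proof -
  have yy: "inner y y = 1"
    using y by (simp add: norm_eq_1)
  have sum_sq: "(\<Sum>w\<in>C. (inner y w)\<^sup>2) = l"
    by (rule sum_squares_eq_frame_eigenvalue[OF y frame])
  have "l * l = inner (l *\<^sub>R y) (l *\<^sub>R y)"
    using yy by simp
  also have "\<dots> = (\<Sum>a\<in>C. \<Sum>b\<in>C. inner y a * inner y b * inner a b)"
    unfolding frame[symmetric]
    unfolding inner_sum_left inner_sum_right by (subst sum.swap) (simp add: mult_ac)
  also have "\<dots> \<le> (\<Sum>a\<in>C. \<Sum>b\<in>C. \<alpha> * (inner y a * inner y b)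
                     + (if b = a then (1 - \<alpha>) * (inner y b)\<^sup>2 else 0))"
  proof (intro sum_mono)
    fix a b assume ab: "a \<in> C" "b \<in> C"
    have pos: "0 \<le> inner y a * inner y b" using nonneg ab by simp
    show "inner y a * inner y b * inner a b
        \<le> \<alpha> * (inner y a * inner y b) + (if b = a then (1 - \<alpha>) * (inner y b)\<^sup>2 else 0)"
    proof (cases "b = a")
      case True
      have "inner a a = 1" using code ab by (simp add: spherical_code_def norm_eq_1)
      thus ?thesis using True by (simp add: power2_eq_square algebra_simps)
    next
      case False
      hence "inner a b \<le> \<alpha>"
        using code ab alpha by (fastforce simp: spherical_code_def)
      thus ?thesis
        using False mult_left_mono[OF _ pos, of "inner a b" \<alpha>] by (simp add: mult_ac)
    qed
  qed
  also have "\<dots> = \<alpha> * (\<Sum>a\<in>C. inner y a)\<^sup>2 + (1 - \<alpha>) * l"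
    using fin
    by (simp add: sum.distrib power2_eq_square sum_product
        flip: sum_distrib_left sum_sq)
  also have "\<dots> \<le> \<alpha> * (real (card C) * l) + (1 - \<alpha>) * l"
  proof -
    have "(\<Sum>a\<in>C. inner y a)\<^sup>2 \<le> l * real (card C)"
      using Cauchy_Schwarz_ineq_sum[of "\<lambda>a. inner y a" "\<lambda>_. 1" C] by (simp add: sum_sq)
    thus ?thesis using alpha by (intro add_right_mono mult_left_mono) (simp_all add: mult_ac)
  qed
  also have "\<dots> = (1 - \<alpha> + \<alpha> * real (card C)) * l"
    by (simp add: algebra_simps)
  finally show ?thesis using l by simp
qed

text \<open>
  The lower bound for \<open>(y \<bullet> u)\<^sup>2\<close> depends on \<open>r = l\<^sup>2 / (n + 24)\<close>. For \<open>l < 60\<close> it suffices that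
  \<open>n + 24 \<ge> 300\<close>: the value \<open>r = l\<^sup>2 / 300\<close> turns both sides of the projection bound into multiples
  of \<open>l - 12\<close>, and cancelling this factor leaves \<open>(y \<bullet> u)\<^sup>2 \<ge> 12 / (l + 12)\<close>. For \<open>l \<ge> 60\<close> the
  estimate \<open>r \<le> l / 5\<close> is better; it comes from the upper bound on \<open>l\<close> in terms of \<open>n\<close>.
\<close>

lemma one_fifth_code_uniform_projection:
  fixes C :: "(real ^ 'd) set" and y u :: "real ^ 'd"
  assumes code: "spherical_code (1 / 5) C" and fin: "finite C"
    and card: "card C \<ge> 276"
    and y: "norm y = 1"
    and frame: "(\<Sum>w\<in>C. inner y w *\<^sub>R w) = l *\<^sub>R y"
    and nonneg: "\<And>w. w \<in> C \<Longrightarrow> inner y w \<ge> 0"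
    and l: "l > 12"
    and u: "u \<in> C"
  shows "(inner y u)\<^sup>2 \<ge> 1 / 6"
proof (rule ccontr)
  define m where "m = real (card C) + 24"
  define r where "r = l\<^sup>2 / m"
  define s where "s = (inner y u)\<^sup>2"
  assume "\<not> ?thesis"
  hence s: "0 \<le> s" "s < 1 / 6" by (simp_all add: s_def)
  have m: "m \<ge> 300" using card by (simp add: m_def)
  have "l \<le> 1 - 1 / 5 + 1 / 5 * real (card C)"
    using l by (intro frame_eigenvalue_upper_bound[OF code fin _ y frame nonneg]) auto
  hence "l \<le> m / 5" by (simp add: m_def)
  hence "l * l \<le> l * (m / 5)" using l by (intro mult_left_mono) auto
  hence r_large: "r \<le> l / 5"
    using m by (simp add: r_def power2_eq_square field_simps)
  have r_small: "r \<le> l\<^sup>2 / 300"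
    unfolding r_def using m by (intro divide_left_mono) auto
  have "(1/5)\<^sup>2 * l - (1 - (1/5)\<^sup>2) / 2
      \<le> s * ((1/5)\<^sup>2 * l\<^sup>2 / (1 - (1/5)\<^sup>2 + (1/5)\<^sup>2 * real (card C)) - (1 - (1/5)\<^sup>2) / 2)"
    unfolding s_def
    by (intro frame_eigenvector_projection_bound[OF code fin _ y frame u]) (simp add: power2_eq_square)
  also have "(1/5)\<^sup>2 * l\<^sup>2 / (1 - (1/5)\<^sup>2 + (1/5)\<^sup>2 * real (card C)) = r"
    by (simp add: r_def m_def power2_eq_square field_simps)
  finally have bound: "l / 25 - 12 / 25 \<le> s * (r - 12 / 25)"
    by (simp add: power2_eq_square)
  have "0 < s * (r - 12 / 25)" using bound l by simp
  hence "0 < r - 12 / 25" using s by (simp add: zero_less_mult_iff)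
  hence "s * (r - 12 / 25) < 1 / 6 * (r - 12 / 25)"
    using s by (intro mult_strict_right_mono)
  hence r_lower: "6 * l - 60 < 25 * r" using bound by simp
  hence "l < 60" using r_large by simp
  hence "(l - 12) * (60 - l) > 0" using l by simp
  moreover have "72 * l - 720 < l\<^sup>2" using r_lower r_small by simp
  ultimately show False by (simp add: power2_eq_square algebra_simps)
qed

text \<open>
  With \<open>k\<close> neighbours, \<open>t = k u + 2 \<Sum>N\<close> satisfies \<open>t \<bullet> t \<le> k\<^sup>2 + 16 k / 5\<close>: the mixed terms with \<open>u\<close>
  cancel the quadratic part of \<open>4 (\<Sum>N) \<bullet> (\<Sum>N) \<le> 4 k (k + 4) / 5\<close>. On the other hand
  \<open>(y \<bullet> t)\<^sup>2 \<ge> (3 k)\<^sup>2 / 6 = 3 k\<^sup>2 / 2\<close>, which forces \<open>k \<le> 32 / 5\<close>.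
\<close>

lemma one_fifth_code_degree_bound:
  fixes C :: "(real ^ 'd) set" and y u :: "real ^ 'd"
  assumes code: "spherical_code (1 / 5) C" and fin: "finite C"
    and y: "norm y = 1"
    and nonneg: "\<And>w. w \<in> C \<Longrightarrow> inner y w \<ge> 0"
    and proj: "\<And>w. w \<in> C \<Longrightarrow> (inner y w)\<^sup>2 \<ge> 1 / 6"
    and u: "u \<in> C"
    and N: "N \<subseteq> C" "\<And>w. w \<in> N \<Longrightarrow> inner u w = - (1 / 5)"
  shows "card N \<le> 6"
proof (rule ccontr)
  define k where "k = real (card N)"
  define z where "z = \<Sum>N"
  define t where "t = k *\<^sub>R u + 2 *\<^sub>R z"
  define c where "c = sqrt (1 / 6)"
  assume "\<not> card N \<le> 6"
  hence k: "k \<ge> 7" by (simp add: k_def)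
  have finN: "finite N" using N fin finite_subset by blast
  have c: "c \<ge> 0" "c\<^sup>2 = 1 / 6" by (simp_all add: c_def)
  have proj': "c \<le> inner y w" if "w \<in> C" for w
    unfolding c_def using proj[OF that] nonneg[OF that] by (intro real_le_lsqrt) auto
  have uz: "inner u z = - k / 5"
  proof -
    have "inner u z = (\<Sum>w\<in>N. - (1 / 5))"
      unfolding z_def inner_sum_right by (intro sum.cong) (auto simp: N)
    thus ?thesis by (simp add: k_def)
  qed
  have zz: "inner z z \<le> k * (k + 4) / 5"
  proof -
    have "inner z z = (\<Sum>a\<in>N. \<Sum>b\<in>N. inner a b)"
      unfolding z_def inner_sum_left inner_sum_right by (rule sum.swap)
    also have "\<dots> \<le> (\<Sum>a\<in>N. \<Sum>b\<in>N. 1 / 5 + (if b = a then 4 / 5 else 0))"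
    proof (intro sum_mono)
      fix a b assume "a \<in> N" "b \<in> N"
      hence ab: "a \<in> C" "b \<in> C" using N by auto
      show "inner a b \<le> 1 / 5 + (if b = a then 4 / 5 else 0)"
        using code ab by (fastforce simp: spherical_code_def norm_eq_1)
    qed
    also have "\<dots> = k * (k + 4) / 5"
      using finN by (simp add: sum.distrib k_def algebra_simps)
    finally show ?thesis .
  qed
  have "inner u u = 1" using code u by (simp add: spherical_code_def norm_eq_1)
  hence "inner t t = k\<^sup>2 - 4 * k\<^sup>2 / 5 + 4 * inner z z"
    using uz by (simp add: t_def inner_add_left inner_add_right inner_commute power2_eq_square)
  hence short: "inner t t \<le> k\<^sup>2 + 16 * k / 5"
    using zz by (simp add: power2_eq_square algebra_simps)
  have "inner y z \<ge> k * c"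
  proof -
    have "inner y z = (\<Sum>w\<in>N. inner y w)"
      by (simp add: z_def inner_sum_right)
    also have "\<dots> \<ge> (\<Sum>w\<in>N. c)"
      using N proj' by (intro sum_mono) auto
    finally show ?thesis by (simp add: k_def)
  qed
  moreover have "k * inner y u \<ge> k * c"
    using proj'[OF u] k by (intro mult_left_mono) auto
  ultimately have "inner y t \<ge> 3 * k * c"
    by (simp add: t_def inner_add_right)
  hence "(3 * k * c)\<^sup>2 \<le> (inner y t)\<^sup>2"
    using k c by (intro power_mono) auto
  hence long: "3 * k\<^sup>2 / 2 \<le> (inner y t)\<^sup>2"
    using c by (simp add: power_mult_distrib)
  have "(inner y t)\<^sup>2 \<le> inner t t"
    using Cauchy_Schwarz_ineq[of y t] y by (simp add: norm_eq_1)
  hence "k * k \<le> 32 / 5 * k"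
    using short long by (simp add: power2_eq_square)
  thus False using k by simp
qed

section \<open>From the Gram matrix to the code\<close>

text \<open>
  If \<open>M x = l x\<close> for the Gram matrix \<open>M\<close> and \<open>z = \<Sum>i<n. x i *\<^sub>R v i\<close>, then \<open>z \<bullet> v i = l (x i)\<close>.
  As \<open>l > 0\<close>, it follows that \<open>z\<close> is nonzero, and is an eigenvector of the frame operator whose inner products with the code
  vectors inherit the signs of \<open>x\<close>.
\<close>

lemma nonneg_gram_eigenvector_imp_frame_eigenvector:
  fixes v :: "nat \<Rightarrow> real ^ 'd"
  assumes bij: "bij_betw v {..<n} C"
    and eig: "eigenvector (gram_matrix n v) x l"
    and nonneg: "\<And>i. i < n \<Longrightarrow> vec_index x i \<ge> 0"
    and l: "l > 0"
  obtains y where "norm y = 1" "(\<Sum>w\<in>C. inner y w *\<^sub>R w) = l *\<^sub>R y"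
    "\<And>w. w \<in> C \<Longrightarrow> inner y w \<ge> 0"
proof -
  define z where "z = (\<Sum>i<n. vec_index x i *\<^sub>R v i)"
  have dim: "x \<in> carrier_vec n" and nz: "x \<noteq> 0\<^sub>v n"
    and eq: "gram_matrix n v *\<^sub>v x = l \<cdot>\<^sub>v x"
    using eig by (auto simp: eigenvector_def gram_matrix_def)
  have z_inner: "inner z (v i) = l * vec_index x i" if i: "i < n" for i
  proof -
    have "l * vec_index x i = vec_index (gram_matrix n v *\<^sub>v x) i"
      using i dim by (simp add: eq)
    also have "\<dots> = (\<Sum>j<n. inner (v i) (v j) * vec_index x j)"
      using i dim by (simp add: gram_matrix_def scalar_prod_def lessThan_atLeast0)
    also have "\<dots> = inner z (v i)"
      unfolding z_def inner_sum_left by (intro sum.cong) (simp_all add: inner_commute)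
    finally show ?thesis by simp
  qed
  have "\<exists>i<n. vec_index x i \<noteq> 0"
    using dim nz by (auto simp: vec_eq_iff)
  hence z0: "z \<noteq> 0"
    using z_inner l by force
  have frame: "(\<Sum>w\<in>C. inner z w *\<^sub>R w) = l *\<^sub>R z"
  proof -
    have "(\<Sum>w\<in>C. inner z w *\<^sub>R w) = (\<Sum>i<n. inner z (v i) *\<^sub>R v i)"
      by (rule sum.reindex_bij_betw[OF bij, symmetric])
    also have "\<dots> = (\<Sum>i<n. (l * vec_index x i) *\<^sub>R v i)"
      by (simp add: z_inner)
    finally show ?thesis
      by (simp add: z_def scaleR_right.sum)
  qed
  show thesis
  proof
    show "norm (z /\<^sub>R norm z) = 1"
      using z0 by simp
    have "(\<Sum>w\<in>C. inner (z /\<^sub>R norm z) w *\<^sub>R w) = (\<Sum>w\<in>C. inner z w *\<^sub>R w) /\<^sub>R norm z"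
      by (simp add: scaleR_right.sum)
    thus "(\<Sum>w\<in>C. inner (z /\<^sub>R norm z) w *\<^sub>R w) = l *\<^sub>R (z /\<^sub>R norm z)"
      by (simp add: frame)
    show "inner (z /\<^sub>R norm z) w \<ge> 0" if "w \<in> C" for w
    proof -
      obtain i where "i < n" "w = v i"
        using \<open>w \<in> C\<close> bij by (auto simp: bij_betw_def)
      thus ?thesis using z_inner nonneg l by simp
    qed
  qed
qed

theorem lemma5:
  fixes C :: "(real ^ 'd) set" and n :: nat and v :: "nat \<Rightarrow> real ^ 'd"
  assumes "n_spherical_code n (1 / 5) C"
    and "n \<ge> 276"
    and "bij_betw v {..<n} C"
    and "largest_eigenvalue (gram_matrix n v) > 12"
    and "\<exists>x. eigenvector (gram_matrix n v) x (largest_eigenvalue (gram_matrix n v)) \<and>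
             (\<forall>i<n. vec_index x i \<ge> 0)"
  shows "max_degree (code_graph (1 / 5) C) \<le> 14"
proof -
  define l where "l = largest_eigenvalue (gram_matrix n v)"
  have code: "spherical_code (1 / 5) C" and fin: "finite C" and card: "card C = n"
    using assms(1) by (auto simp: n_spherical_code_def)
  have l: "l > 12" using assms(4) by (simp add: l_def)
  obtain x where "eigenvector (gram_matrix n v) x l" "\<And>i. i < n \<Longrightarrow> vec_index x i \<ge> 0"
    using assms(5) by (auto simp: l_def)
  moreover have "l > 0" using l by simp
  ultimately obtain y where y: "norm y = 1" "(\<Sum>w\<in>C. inner y w *\<^sub>R w) = l *\<^sub>R y"
    "\<And>w. w \<in> C \<Longrightarrow> inner y w \<ge> 0"
    using nonneg_gram_eigenvector_imp_frame_eigenvector[OF assms(3)] by blast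
  have proj: "(inner y w)\<^sup>2 \<ge> 1 / 6" if "w \<in> C" for w
    using card assms(2)
    by (intro one_fifth_code_uniform_projection[OF code fin _ y l that]) auto
  have deg: "card (neighbours (code_graph (1 / 5) C) u) \<le> 14" if u: "u \<in> C" for u
  proof -
    have "card (neighbours (code_graph (1 / 5) C) u) \<le> 6"
      by (rule one_fifth_code_degree_bound[OF code fin y(1) y(3) proj u])
         (auto simp: neighbours_def code_graph_def doubleton_eq_iff inner_commute)
    thus ?thesis by simp
  qed
  have "C \<noteq> {}" using card assms(2) by auto
  thus ?thesis
    using fin deg by (simp add: max_degree_def code_graph_def)
qed

end
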